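(* Let $\mathcal{I} = ((\mathcal{F}_i)_{i=1}^n,\pi)$ be an instance of the hiring problem, let $\mathrm{OPTOff}$ be the optimal offline algorithm (which hires a candidate $i^*\in\arg\max_i X_i$, so $\mathbb{E}[\mathrm{OPTOff}] = \mathbb{E}[\max_i X_i]$), and let $\mathrm{OPTOnIIF}$ be an optimal (expected-value-maximizing) IIF stopping rule for $\mathcal{I}$. Then \[ \mathbb{E}[\mathrm{OPTOnIIF}] \ge \tfrac12\, \mathbb{E}[\mathrm{OPTOff}]. \] Moreover the inequality is tight: for every $c>1/2$ there is an instance for which $\mathbb{E}[\mathrm{OPTOnIIF}] < c\,\mathbb{E}[\mathrm{OPTOff}]$.
   Context: Hiring problem: $n$ candidates; candidate $i$ has a nonnegative random value $X_i\sim\mathcal{F}_i$, the $X_i$ independent, each $\mathcal{F}_i$ discrete; $f_i(x)=\Pr[X_i=x]$, $\mathcal{S}=\bigcup_i\{x:f_i(x)>0\}$. An instance with arrival ordering is $((\mathcal{F}_i)_{i=1}^n,\pi)$ with $\pi$ a permutation of $[n]$: at step $t$ candidate $\pi(t)$ arrives, $X_{\pi(t)}$ is revealed, and the decision maker either hires $\pi(t)$ (and stops) or rejects it irrevocably. A stopping rule is a possibly randomized procedure knowing $n$, the $\mathcal{F}_i$, $\pi$, deciding at step $t$ using only $X_{\pi(1)},\dots,X_{\pi(t)}$ (and own randomness), hiring at most one candidate. An offline algorithm sees all of $X_1,\dots,X_n$ and then hires at most one candidate. An algorithm's name also denotes the value of the hired candidate ($0$ if none). An algorithm is IIF with probability function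 $p:\mathcal{S}\to[0,1]$ if $\Pr[\mathrm{ALG}\text{ hires } i\mid X_i=x]=p(x)$ for all $i\in[n]$, $x\in\mathcal{S}$; IIF means IIF with some such $p$. *)

theory Defs
  imports "HOL-Probability.Probability" "HOL-Combinatorics.Permutations"
begin

text \<open>
  Candidates are \<open>1, \<dots>, n\<close>; \<open>F i\<close> is the law of the value of candidate \<open>i\<close> (any discrete
  law on the nonnegative reals, possibly with infinite support and infinite mean); candidate
  \<open>\<pi> t\<close> arrives at step \<open>t\<close>.
\<close>

definition hiring_instance :: "nat \<Rightarrow> (nat \<Rightarrow> real pmf) \<Rightarrow> (nat \<Rightarrow> nat) \<Rightarrow> bool" where
  "hiring_instance n F \<pi> \<longleftrightarrow>
     1 \<le> n \<and> (\<forall>i\<in>{1..n}. set_pmf (F i) \<subseteq> {0..}) \<and> \<pi> permutes {1..n}"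

text \<open>The joint law of the independent values; profiles are \<open>0\<close> outside \<open>{1..n}\<close>.\<close>

definition value_law :: "nat \<Rightarrow> (nat \<Rightarrow> real pmf) \<Rightarrow> (nat \<Rightarrow> real) pmf" where
  "value_law n F = Pi_pmf {1..n} 0 F"

definition support :: "nat \<Rightarrow> (nat \<Rightarrow> real pmf) \<Rightarrow> real set" where
  "support n F = (\<Union>i\<in>{1..n}. {v. pmf (F i) v > 0})"

text \<open>
  An algorithm, online or offline, is given by the conditional law of the hired candidate
  (\<open>None\<close> if nobody is hired) given the profile of all values.
\<close>

type_synonym algorithm = "(nat \<Rightarrow> real) \<Rightarrow> nat option pmf"

definition outcome :: "nat \<Rightarrow> (nat \<Rightarrow> real pmf) \<Rightarrow> algorithm \<Rightarrow> ((nat \<Rightarrow> real) \<times> nat option) pmf" where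
  "outcome n F A = bind_pmf (value_law n F) (\<lambda>x. map_pmf (Pair x) (A x))"

definition hired_value :: "(nat \<Rightarrow> real) \<Rightarrow> nat option \<Rightarrow> real" where
  "hired_value x h = (case h of None \<Rightarrow> 0 | Some i \<Rightarrow> x i)"

text \<open>Values are nonnegative, so expectations are taken in \<open>[0, \<infinity>]\<close>.\<close>

definition expected_value :: "nat \<Rightarrow> (nat \<Rightarrow> real pmf) \<Rightarrow> algorithm \<Rightarrow> ennreal" where
  "expected_value n F A = (\<integral>\<^sup>+ (x, h). ennreal (hired_value x h) \<partial>measure_pmf (outcome n F A))"

definition expected_max :: "nat \<Rightarrow> (nat \<Rightarrow> real pmf) \<Rightarrow> ennreal" where
  "expected_max n F = (\<integral>\<^sup>+ x. ennreal (Max (x ` {1..n})) \<partial>measure_pmf (value_law n F))"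

definition offline_algorithm :: "nat \<Rightarrow> algorithm \<Rightarrow> bool" where
  "offline_algorithm n A \<longleftrightarrow> (\<forall>x. set_pmf (A x) \<subseteq> insert None (Some ` {1..n}))"

definition optimal_offline :: "nat \<Rightarrow> (nat \<Rightarrow> real pmf) \<Rightarrow> algorithm \<Rightarrow> bool" where
  "optimal_offline n F A \<longleftrightarrow> offline_algorithm n A \<and>
     (\<forall>B. offline_algorithm n B \<longrightarrow> expected_value n F B \<le> expected_value n F A)"

text \<open>Ties may be broken in any way, also at random.\<close>

definition hires_maximum :: "nat \<Rightarrow> algorithm \<Rightarrow> bool" where
  "hires_maximum n A \<longleftrightarrow> (\<forall>x. set_pmf (A x) \<subseteq> Some ` {i. is_arg_max x (\<lambda>j. j \<in> {1..n}) i})"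

text \<open>
  \<open>run d x ys cs\<close> is the law of the candidate hired from the list \<open>cs\<close> of candidates still to
  arrive, when the values \<open>ys\<close> have been revealed so far (in order of arrival) and everyone was
  rejected. When a candidate arrives and the revealed values, including the new one, are \<open>zs\<close>,
  the decision maker draws the decision to hire from \<open>d zs\<close>. As all earlier decisions were
  rejections, \<open>zs\<close> is the whole history of the process.
\<close>

fun run :: "(real list \<Rightarrow> bool pmf) \<Rightarrow> (nat \<Rightarrow> real) \<Rightarrow> real list \<Rightarrow> nat list \<Rightarrow> nat option pmf" where
  "run d x ys [] = return_pmf None"
| "run d x ys (i # cs) = bind_pmf (d (ys @ [x i]))
     (\<lambda>hire. if hire then return_pmf (Some i) else run d x (ys @ [x i]) cs)"

definition stopping_rule :: "nat \<Rightarrow> (nat \<Rightarrow> nat) \<Rightarrow> algorithm \<Rightarrow> bool" where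
  "stopping_rule n \<pi> A \<longleftrightarrow> (\<exists>d. \<forall>x. A x = run d x [] (map \<pi> [1..<Suc n]))"

text \<open>
  The condition on \<open>Pr(A hires i | X\<^sub>i = v)\<close> is imposed whenever the conditioning event has
  positive probability; otherwise this conditional probability is undefined (and \<open>cond_prob\<close>
  would return \<open>0\<close>).
\<close>

definition IIF_with :: "nat \<Rightarrow> (nat \<Rightarrow> real pmf) \<Rightarrow> (real \<Rightarrow> real) \<Rightarrow> algorithm \<Rightarrow> bool" where
  "IIF_with n F p A \<longleftrightarrow> (\<forall>v\<in>support n F. p v \<in> {0..1}) \<and>
     (\<forall>i\<in>{1..n}. \<forall>v\<in>support n F. pmf (F i) v > 0 \<longrightarrow>
        cond_prob (measure_pmf (outcome n F A)) (\<lambda>(x, h). h = Some i) (\<lambda>(x, h). x i = v) = p v)"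

definition IIF :: "nat \<Rightarrow> (nat \<Rightarrow> real pmf) \<Rightarrow> algorithm \<Rightarrow> bool" where
  "IIF n F A \<longleftrightarrow> (\<exists>p. IIF_with n F p A)"

definition optimal_IIF_stopping_rule ::
    "nat \<Rightarrow> (nat \<Rightarrow> real pmf) \<Rightarrow> (nat \<Rightarrow> nat) \<Rightarrow> algorithm \<Rightarrow> bool" where
  "optimal_IIF_stopping_rule n F \<pi> A \<longleftrightarrow> stopping_rule n \<pi> A \<and> IIF n F A \<and>
     (\<forall>B. stopping_rule n \<pi> B \<and> IIF n F B \<longrightarrow> expected_value n F B \<le> expected_value n F A)"

end

(*
  For an IIF stopping rule with probability function p, the event that a candidate's step is
  reached is independent of the value of the candidate, and has probability 1 minus the sum of
  E[p(X_j)] over the candidates j that arrive earlier. Hence p(v) is at most this probability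
  whenever the candidate can have value v; conversely, a p with this property is realised by hiring
  with the probability p(v) divided by that of reaching the step. The value of the rule is the
  linear functional sum_i E[X_i p(X_i)] of p.

  With f = sum_i f_i, the function p(v) = Pr[max X = v] / (2 f(v)) satisfies p <= 1/2 and
  sum_i E[p(X_i)] = 1/2, so it is feasible, and its value is E[max X] / 2. If E[max X] is finite,
  an optimal p is a pointwise limit of a maximising sequence, by dominated convergence; otherwise
  the p above already has infinite value.

  Tightness: X_1 = 1 arrives first, and X_2 is 1/e with probability e and 0 otherwise.
*)

theory Submission
  imports Defs "HOL-Complex_Analysis.Great_Picard"
begin

section \<open>Independence in product laws, the law of a run, and disintegration along a random
  value\<close>

text \<open>Coordinate \<open>i\<close> of the product law can be split off as an independent draw.
  The hypothesis on \<open>r\<close> says that \<open>r\<close> ignores this coordinate, so the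
  integral over the pair factorises.\<close>

lemma nn_integral_Pi_pmf_indep:
  fixes g :: "'b \<Rightarrow> ennreal" and r :: "('a \<Rightarrow> 'b) \<Rightarrow> ennreal"
  assumes "finite I" "i \<in> I" and r: "\<And>x y. r (x(i := y)) = r x"
  shows "(\<integral>\<^sup>+x. g (x i) * r x \<partial>Pi_pmf I dflt F) = (\<integral>\<^sup>+v. g v \<partial>F i) * (\<integral>\<^sup>+x. r x \<partial>Pi_pmf I dflt F)"
proof -
  have eq: "Pi_pmf I dflt F = map_pmf (\<lambda>(y, f). f(i := y)) (pair_pmf (F i) (Pi_pmf (I - {i}) dflt F))"
    using Pi_pmf_insert[of "I - {i}" i dflt F] assms(1,2) by (simp add: insert_absorb)
  show ?thesis
    unfolding eq by (simp add: nn_integral_pair_pmf' r nn_integral_cmult nn_integral_multc)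
qed

lemma expectation_Pi_pmf_indep:
  fixes g :: "'b \<Rightarrow> real" and r :: "('a \<Rightarrow> 'b) \<Rightarrow> real"
  assumes "finite I" "i \<in> I" and "\<And>x y. r (x(i := y)) = r x"
    and "\<And>v. 0 \<le> g v" "\<And>x. 0 \<le> r x"
  shows "measure_pmf.expectation (Pi_pmf I dflt F) (\<lambda>x. g (x i) * r x) =
    measure_pmf.expectation (F i) g * measure_pmf.expectation (Pi_pmf I dflt F) r"
proof -
  have "(\<integral>\<^sup>+x. ennreal (g (x i) * r x) \<partial>Pi_pmf I dflt F) =
      (\<integral>\<^sup>+v. ennreal (g v) \<partial>F i) * (\<integral>\<^sup>+x. ennreal (r x) \<partial>Pi_pmf I dflt F)"
    using nn_integral_Pi_pmf_indep[of I i, where r = "\<lambda>x. ennreal (r x)" and g = "\<lambda>v. ennreal (g v)"] assms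
    by (simp add: ennreal_mult)
  then show ?thesis
    using assms by (simp add: integral_eq_nn_integral enn2real_mult)
qed

text \<open>A candidate is hired exactly when all earlier decisions are rejections and its own is
  not. The histories have length \<open>Suc s\<close> because each contains the value just
  revealed.\<close>

lemma pmf_run_Some:
  assumes "distinct cs" "t < length cs"
  shows "pmf (run d x ys cs) (Some (cs ! t)) =
    (\<Prod>s<t. pmf (d (ys @ map x (take (Suc s) cs))) False) * pmf (d (ys @ map x (take (Suc t) cs))) True"
  using assms
proof (induction cs arbitrary: t ys)
  case Nil
  then show ?case by simp
next
  case (Cons i cs)
  have *: "pmf (run d x ys (i # cs)) y = pmf (d (ys @ [x i])) True * indicator {Some i} y
      + pmf (d (ys @ [x i])) False * pmf (run d x (ys @ [x i]) cs) y" for y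
    by (simp add: pmf_bind integral_measure_pmf[of UNIV] UNIV_bool pmf_return indicator_def)
  \<comment> \<open>Distinctness enters here: a candidate rejected at the head of the list gets no
    second chance.\<close>
  have notin: "pmf (run d x zs cs) (Some i) = 0" if "i \<notin> set cs" for zs cs
    using that
    by (induction cs arbitrary: zs)
       (auto simp: pmf_bind integral_measure_pmf[of UNIV] UNIV_bool pmf_return indicator_def)
  show ?case
  proof (cases t)
    case 0
    with Cons.prems * show ?thesis by (simp add: notin)
  next
    case (Suc u)
    have "cs ! u \<noteq> i" using Cons.prems Suc by auto
    then have "pmf (run d x ys (i # cs)) (Some ((i # cs) ! t)) =
        pmf (d (ys @ [x i])) False * pmf (run d x (ys @ [x i]) cs) (Some (cs ! u))"
      unfolding * by (simp add: Suc)
    with Cons.IH[of u "ys @ [x i]"] Cons.prems Suc show ?thesis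
      by (simp add: prod.lessThan_Suc_shift mult.assoc del: prod.lessThan_Suc run.simps)
  qed
qed

text \<open>When \<open>Q\<close> is the law of \<open>X\<close>, \<open>cond\<close> says that
  \<open>p v\<close> is the conditional mean of \<open>w\<close> given \<open>X = v\<close>. Summing
  over the countably many fibres of \<open>X\<close> then replaces \<open>w\<close> by
  \<open>p\<close> of \<open>X\<close>. With \<open>w\<close> a hiring probability,
  \<open>g = 1\<close> gives the chance of being hired and \<open>g = ennreal\<close> the expected
  contribution.\<close>

lemma nn_integral_disintegrate_pmf:
  fixes P :: "'a pmf" and Q :: "'b pmf"
  assumes marg: "\<And>x. x \<in> set_pmf P \<Longrightarrow> X x \<in> set_pmf Q"
    and cond: "\<And>v. v \<in> set_pmf Q \<Longrightarrow>
      measure_pmf.expectation P (\<lambda>x. indicator {v} (X x) * w x) = pmf Q v * p v"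
    and w: "\<And>x. 0 \<le> w x" "\<And>x. w x \<le> 1"
  shows "(\<integral>\<^sup>+x. g (X x) * ennreal (w x) \<partial>P) = (\<integral>\<^sup>+v. g v * ennreal (p v) \<partial>Q)"
proof -
  \<comment> \<open>Only the summand \<open>v = X x\<close> is non-zero, and \<open>marg\<close>
    puts it in the range of summation.\<close>
  have "(\<integral>\<^sup>+x. g (X x) * ennreal (w x) \<partial>P) =
      (\<integral>\<^sup>+x. (\<integral>\<^sup>+v. g v * ennreal (indicator {v} (X x) * w x) \<partial>count_space (set_pmf Q)) \<partial>P)"
  proof (rule nn_integral_cong_AE, simp add: AE_measure_pmf_iff, rule ballI)
    fix x assume "x \<in> set_pmf P"
    have "(\<integral>\<^sup>+v. g v * ennreal (indicator {v} (X x) * w x) \<partial>count_space (set_pmf Q)) =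
       (\<integral>\<^sup>+v. (g (X x) * ennreal (w x)) * indicator {X x} v \<partial>count_space (set_pmf Q))"
      by (intro nn_integral_cong) (auto simp: indicator_def)
    also have "\<dots> = g (X x) * ennreal (w x)"
      using marg[OF \<open>x \<in> set_pmf P\<close>] by (subst nn_integral_cmult_indicator) auto
    finally show "g (X x) * ennreal (w x) = (\<integral>\<^sup>+v. g v * ennreal (indicator {v} (X x) * w x) \<partial>count_space (set_pmf Q))"
      by simp
  qed
  also have "\<dots> = (\<integral>\<^sup>+v. (\<integral>\<^sup>+x. g v * ennreal (indicator {v} (X x) * w x) \<partial>P) \<partial>count_space (set_pmf Q))"
    by (rule nn_integral_count_space_nn_integral) auto
  also have "\<dots> = (\<integral>\<^sup>+v. g v * ennreal (pmf Q v * p v) \<partial>count_space (set_pmf Q))"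
  proof (rule nn_integral_cong)
    fix v assume "v \<in> space (count_space (set_pmf Q))"
    then have v: "v \<in> set_pmf Q" by simp
    have "integrable P (\<lambda>x. indicator {v} (X x) * w x)"
      by (rule measure_pmf.integrable_const_bound[where B=1]) (auto simp: w indicator_def)
    then show "(\<integral>\<^sup>+x. g v * ennreal (indicator {v} (X x) * w x) \<partial>P) = g v * ennreal (pmf Q v * p v)"
      using w by (simp add: nn_integral_cmult nn_integral_eq_integral cond[OF v] flip: ennreal_mult'')
  qed
  also have "\<dots> = (\<integral>\<^sup>+v. g v * ennreal (p v) \<partial>Q)"
    by (subst nn_integral_measure_pmf)
       (auto simp: nn_integral_count_space_indicator indicator_def ennreal_mult' set_pmf_iff mult.left_commute
         intro!: nn_integral_cong)
  finally show ?thesis .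
qed

section \<open>Fairness as a condition on expectations over value profiles\<close>

lemma hiring_prob_outcome:
  "measure (measure_pmf (outcome n F A)) {(x, h). h = Some i \<and> x i = v} =
    measure_pmf.expectation (value_law n F) (\<lambda>x. indicator {v} (x i) * pmf (A x) (Some i))"
proof -
  let ?S = "{(x, h). h = Some i \<and> x i = v}"
  have eq: "emeasure (measure_pmf (A x)) (Pair x -` ?S) = ennreal (indicator {v} (x i) * pmf (A x) (Some i))" for x
  proof (cases "x i = v")
    case True
    then have "Pair x -` ?S = {Some i}" by auto
    with True show ?thesis by (simp add: emeasure_pmf_single)
  next
    case False
    then have "Pair x -` ?S = {}" by auto
    with False show ?thesis by simp
  qed
  have "emeasure (measure_pmf (outcome n F A)) ?S =
      (\<integral>\<^sup>+x. ennreal (indicator {v} (x i) * pmf (A x) (Some i)) \<partial>value_law n F)"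
    unfolding outcome_def emeasure_bind_pmf emeasure_map_pmf eq ..
  then show ?thesis
    by (simp add: measure_def integral_eq_nn_integral)
qed

lemma nn_integral_outcome:
  "(\<integral>\<^sup>+y. f y \<partial>outcome n F A) = (\<integral>\<^sup>+x. (\<integral>\<^sup>+h. f (x, h) \<partial>A x) \<partial>value_law n F)"
  by (simp add: outcome_def)

lemma value_law_component:
  assumes "i \<in> {1..n}"
  shows "map_pmf (\<lambda>x. x i) (value_law n F) = F i"
  using assms by (simp add: value_law_def Pi_pmf_component)

lemma value_law_component_in_set_pmf:
  assumes "i \<in> {1..n}" "x \<in> set_pmf (value_law n F)"
  shows "x i \<in> set_pmf (F i)"
  using assms by (auto simp flip: value_law_component[OF assms(1)])

text \<open>On the support of \<open>F i\<close> the conditioning event has probability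
  \<open>pmf (F i) v > 0\<close>, so the quotient in \<open>cond_prob\<close> can be cleared. The
  resulting integral over profiles is open to independence arguments.\<close>

lemma IIF_with_iff:
  "IIF_with n F p A \<longleftrightarrow> (\<forall>v\<in>support n F. p v \<in> {0..1}) \<and>
     (\<forall>i\<in>{1..n}. \<forall>v\<in>set_pmf (F i).
        measure_pmf.expectation (value_law n F) (\<lambda>x. indicator {v} (x i) * pmf (A x) (Some i)) =
          pmf (F i) v * p v)"
proof -
  have "cond_prob (measure_pmf (outcome n F A)) (\<lambda>(x, h). h = Some i) (\<lambda>(x, h). x i = v) = p v \<longleftrightarrow>
      measure_pmf.expectation (value_law n F) (\<lambda>x. indicator {v} (x i) * pmf (A x) (Some i)) = pmf (F i) v * p v"
    if i: "i \<in> {1..n}" and v: "v \<in> set_pmf (F i)" for i v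
  proof -
    have fst: "map_pmf fst (outcome n F A) = value_law n F"
      by (simp add: outcome_def map_bind_pmf pmf.map_comp o_def bind_return_pmf')
    have marg: "map_pmf (\<lambda>y. fst y i) (outcome n F A) = F i"
      using value_law_component[OF i, of F] by (simp add: pmf.map_comp o_def flip: fst)
    have "pmf (F i) v = measure (measure_pmf (outcome n F A)) {y. fst y i = v}"
      unfolding marg[symmetric] by (simp add: pmf_map vimage_def)
    moreover have "measure (measure_pmf (outcome n F A)) {y. snd y = Some i \<and> fst y i = v} =
        measure_pmf.expectation (value_law n F) (\<lambda>x. indicator {v} (x i) * pmf (A x) (Some i))"
      using hiring_prob_outcome[of n F A i v] by (simp add: case_prod_unfold)
    moreover have "pmf (F i) v > 0" using v by (simp add: pmf_positive)
    ultimately show ?thesis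
      by (simp only: cond_prob_def case_prod_unfold space_measure_pmf UNIV_I simp_thms
          divide_eq_eq mult.commute[of "p v"]) simp
  qed
  moreover have "v \<in> support n F" if "i \<in> {1..n}" "v \<in> set_pmf (F i)" for i v
    using that by (auto simp: support_def pmf_positive intro!: bexI[of _ i])
  ultimately show ?thesis
    unfolding IIF_with_def pmf_positive_iff by blast
qed

lemma nn_integral_value_law_component:
  assumes "i \<in> {1..n}"
  shows "(\<integral>\<^sup>+x. g (x i) \<partial>value_law n F) = (\<integral>\<^sup>+v. g v \<partial>F i)"
  by (subst value_law_component[OF assms, of F, symmetric]) simp

lemma is_arg_max_eq_Max:
  fixes x :: "'a \<Rightarrow> 'b :: linorder"
  assumes "finite I" "is_arg_max x (\<lambda>j. j \<in> I) i"
  shows "x i = Max (x ` I)"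
  using assms by (intro Max_eqI[symmetric]) (auto simp: is_arg_max_linorder)

section \<open>IIF stopping rules as feasible probability functions\<close>

locale hiring =
  fixes n :: nat and F :: "nat \<Rightarrow> real pmf" and \<pi> :: "nat \<Rightarrow> nat"
  assumes hiring: "hiring_instance n F \<pi>"
begin

definition arrivals :: "nat list" where
  "arrivals = map \<pi> [1..<Suc n]"

lemma permutes: "\<pi> permutes {1..n}"
  using hiring by (simp add: hiring_instance_def)

lemma n_pos: "1 \<le> n"
  using hiring by (simp add: hiring_instance_def)

lemma value_nonneg: "i \<in> {1..n} \<Longrightarrow> v \<in> set_pmf (F i) \<Longrightarrow> 0 \<le> v"
  using hiring by (auto simp: hiring_instance_def)

lemma distinct_arrivals: "distinct arrivals"
  using permutes_inj_on[OF permutes] by (simp add: arrivals_def distinct_map del: upt_Suc)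

lemma set_arrivals: "set arrivals = {1..n}"
  using permutes_image[OF permutes] by (simp add: arrivals_def atLeastLessThanSuc_atLeastAtMost del: upt_Suc)

lemma length_arrivals: "length arrivals = n"
  by (simp add: arrivals_def del: upt_Suc)

lemma arrival_in: "t < n \<Longrightarrow> arrivals ! t \<in> {1..n}"
  using nth_mem[of t arrivals] set_arrivals length_arrivals by metis

lemma arrival_cases:
  assumes "i \<in> {1..n}"
  obtains t where "t < n" "i = arrivals ! t"
  using assms set_arrivals length_arrivals by (metis in_set_conv_nth)

lemma sum_arrivals: "(\<Sum>t<n. f (arrivals ! t)) = (\<Sum>i\<in>{1..n}. f i)"
  by (rule sum.reindex_bij_betw)
     (metis bij_betw_nth distinct_arrivals set_arrivals length_arrivals)

text \<open>
  For a rule that is individually fair with \<open>p\<close>, the probability that step \<open>t\<close> (counted from \<open>0\<close>)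
  is reached.
\<close>

definition reach_prob :: "(real \<Rightarrow> real) \<Rightarrow> nat \<Rightarrow> real" where
  "reach_prob p t = 1 - (\<Sum>s<t. measure_pmf.expectation (F (arrivals ! s)) p)"

text \<open>The second clause makes \<open>p v / reach_prob p t\<close> a probability for every
  value the arriving candidate can have. The bounds are asked on all reals so that \<open>p\<close>
  is a bounded integrand.\<close>

definition feasible :: "(real \<Rightarrow> real) \<Rightarrow> bool" where
  "feasible p \<longleftrightarrow> (\<forall>v. p v \<in> {0..1}) \<and>
     (\<forall>t<n. \<forall>v\<in>set_pmf (F (arrivals ! t)). p v \<le> reach_prob p t)"

definition fair_value :: "(real \<Rightarrow> real) \<Rightarrow> ennreal" where
  "fair_value p = (\<Sum>i\<in>{1..n}. \<integral>\<^sup>+v. ennreal v * ennreal (p v) \<partial>F i)"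

abbreviation rule :: "(real list \<Rightarrow> bool pmf) \<Rightarrow> algorithm" where
  "rule d \<equiv> \<lambda>x. run d x [] arrivals"

text \<open>The conditional probability, given the profile \<open>x\<close>, that step
  \<open>t\<close> (counted from 0) is reached.\<close>

definition reached :: "(real list \<Rightarrow> bool pmf) \<Rightarrow> nat \<Rightarrow> (nat \<Rightarrow> real) \<Rightarrow> real" where
  "reached d t x = (\<Prod>s<t. pmf (d (map x (take (Suc s) arrivals))) False)"

lemma reached_nonneg: "0 \<le> reached d t x"
  by (simp add: reached_def prod_nonneg)

lemma reached_le_1: "reached d t x \<le> 1"
  by (simp add: reached_def prod_le_1 pmf_le_1)

lemma pmf_rule:
  assumes "t < n"
  shows "pmf (rule d x) (Some (arrivals ! t)) = reached d t x * pmf (d (map x (take (Suc t) arrivals))) True"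
  using pmf_run_Some[OF distinct_arrivals, of t d x "[]"] assms length_arrivals
  by (simp add: reached_def)

lemma reached_Suc:
  assumes "t < n"
  shows "reached d (Suc t) x = reached d t x - pmf (rule d x) (Some (arrivals ! t))"
  unfolding pmf_rule[OF assms] by (simp add: reached_def pmf_False_conv_True algebra_simps)

text \<open>The decisions before step \<open>t\<close> see only the values of earlier arrivals,
  which are other candidates. This is what makes reaching the step independent of the value found
  there.\<close>

lemma reached_upd:
  assumes "t < n"
  shows "reached d t (x(arrivals ! t := y)) = reached d t x"
proof -
  have "map (x(arrivals ! t := y)) (take (Suc s) arrivals) = map x (take (Suc s) arrivals)" if "s < t" for s
  proof (rule map_cong[OF refl])
    fix i assume "i \<in> set (take (Suc s) arrivals)"
    then obtain u where "u < Suc s" "u < n" "i = arrivals ! u"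
      using length_arrivals by (auto simp: in_set_conv_nth)
    then have "i \<noteq> arrivals ! t"
      using distinct_arrivals length_arrivals assms that nth_eq_iff_index_eq[OF distinct_arrivals, of u t]
      by simp
    then show "(x(arrivals ! t := y)) i = x i" by simp
  qed
  then show ?thesis
    unfolding reached_def by (metis (no_types, lifting) lessThan_iff prod.cong)
qed

abbreviation "expect \<equiv> measure_pmf.expectation (value_law n F)"

lemma expect_reached_Suc:
  assumes "t < n"
  shows "expect (reached d (Suc t)) = expect (reached d t) - expect (\<lambda>x. pmf (rule d x) (Some (arrivals ! t)))"
proof -
  have "integrable (value_law n F) (reached d t)"
    by (rule measure_pmf.integrable_const_bound[where B=1])
       (auto simp: reached_nonneg reached_le_1)
  moreover have "integrable (value_law n F) (\<lambda>x. pmf (rule d x) (Some (arrivals ! t)))"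
    by (rule measure_pmf.integrable_const_bound[where B=1]) (auto simp: pmf_le_1)
  ultimately show ?thesis
    unfolding reached_Suc[OF assms] by simp
qed

text \<open>Averaging the fairness condition over the values of the candidate gives the mass that
  each step removes from the probability of continuing.\<close>

lemma expect_hire_eq:
  assumes "i \<in> {1..n}" and p: "\<And>v. 0 \<le> p v" "\<And>v. p v \<le> 1"
    and "\<And>v. v \<in> set_pmf (F i) \<Longrightarrow>
      expect (\<lambda>x. indicator {v} (x i) * pmf (A x) (Some i)) = pmf (F i) v * p v"
  shows "expect (\<lambda>x. pmf (A x) (Some i)) = measure_pmf.expectation (F i) p"
proof -
  have "(\<integral>\<^sup>+x. 1 * ennreal (pmf (A x) (Some i)) \<partial>value_law n F) = (\<integral>\<^sup>+v. 1 * ennreal (p v) \<partial>F i)"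
    by (rule nn_integral_disintegrate_pmf[where X = "\<lambda>x. x i" and g = "\<lambda>_. 1"])
       (use assms value_law_component_in_set_pmf in \<open>auto simp: pmf_le_1\<close>)
  then show ?thesis
    using p by (simp add: integral_eq_nn_integral)
qed

lemma expected_value_eq:
  assumes "offline_algorithm n A"
  shows "expected_value n F A = (\<Sum>i\<in>{1..n}. \<integral>\<^sup>+x. ennreal (x i) * ennreal (pmf (A x) (Some i)) \<partial>value_law n F)"
proof -
  have "(\<integral>\<^sup>+h. ennreal (hired_value x h) \<partial>A x) = (\<Sum>i\<in>{1..n}. ennreal (x i) * ennreal (pmf (A x) (Some i)))" for x
  proof -
    have "set_pmf (A x) \<subseteq> insert None (Some ` {1..n})"
      using assms by (simp add: offline_algorithm_def)
    then have "(\<integral>\<^sup>+h. ennreal (hired_value x h) \<partial>A x) =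
        (\<Sum>h\<in>insert None (Some ` {1..n}). ennreal (hired_value x h) * ennreal (pmf (A x) h))"
      by (subst nn_integral_measure_pmf_support[where A = "insert None (Some ` {1..n})"]) auto
    also have "\<dots> = (\<Sum>h\<in>Some ` {1..n}. ennreal (hired_value x h) * ennreal (pmf (A x) h))"
      by (subst sum.insert) (auto simp: hired_value_def)
    also have "\<dots> = (\<Sum>i\<in>{1..n}. ennreal (x i) * ennreal (pmf (A x) (Some i)))"
      by (subst sum.reindex) (auto simp: hired_value_def)
    finally show ?thesis .
  qed
  then show ?thesis
    unfolding expected_value_def nn_integral_outcome by (simp add: nn_integral_sum)
qed

lemma offline_rule: "offline_algorithm n (rule d)"
proof -
  have "set_pmf (run d x ys cs) \<subseteq> insert None (Some ` set cs)" for x ys cs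
    by (induction cs arbitrary: ys) (auto split: if_splits, blast)
  then show ?thesis
    unfolding offline_algorithm_def using set_arrivals by metis
qed

text \<open>Disintegration along the value of each candidate shows that a fair rule influences its
  expected value only through \<open>p\<close>.\<close>

lemma expected_value_IIF:
  assumes "stopping_rule n \<pi> A" "IIF_with n F p A"
  shows "expected_value n F A = fair_value p"
proof -
  obtain d where "A = rule d"
    using assms(1) unfolding stopping_rule_def arrivals_def by blast
  then have "offline_algorithm n A" by (simp add: offline_rule)
  then show ?thesis
    unfolding expected_value_eq[OF \<open>offline_algorithm n A\<close>] fair_value_def
    using assms(2) value_law_component_in_set_pmf
    by (intro sum.cong refl nn_integral_disintegrate_pmf) (auto simp: IIF_with_iff pmf_le_1)
qed

text \<open>To be hired with value \<open>v\<close> a candidate must have this value and its step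
  must be reached. These events are independent, so \<open>p v\<close> is at most the probability of
  the second.\<close>

lemma IIF_feasible:
  assumes A: "stopping_rule n \<pi> A" and "IIF n F A"
  obtains p where "feasible p" "IIF_with n F p A"
proof -
  obtain p0 where p0: "IIF_with n F p0 A"
    using \<open>IIF n F A\<close> by (auto simp: IIF_def)
  \<comment> \<open>Fairness fixes the function only on the support; the default 0 gives the bounds
    that \<open>feasible\<close> asks everywhere.\<close>
  define p where "p v = (if v \<in> support n F then p0 v else 0)" for v
  have p01: "0 \<le> p v" "p v \<le> 1" for v
    using p0 by (auto simp: p_def IIF_with_def)
  have p: "IIF_with n F p A"
    using p0 by (auto simp: IIF_with_def p_def)
  obtain d where d: "A = rule d"
    using A unfolding stopping_rule_def arrivals_def by blast
  have hire: "expect (\<lambda>x. indicator {v} (x i) * pmf (rule d x) (Some i)) = pmf (F i) v * p v"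
    if "i \<in> {1..n}" "v \<in> set_pmf (F i)" for i v
    using p that unfolding IIF_with_iff d by blast
  have reach: "expect (reached d t) = reach_prob p t" if "t \<le> n" for t
    using that
  proof (induction t)
    case 0
    then show ?case by (simp add: reached_def[abs_def] reach_prob_def)
  next
    case (Suc t)
    then have "t < n" by simp
    have "expect (\<lambda>x. pmf (rule d x) (Some (arrivals ! t))) = measure_pmf.expectation (F (arrivals ! t)) p"
      using arrival_in[OF \<open>t < n\<close>] p01 hire by (intro expect_hire_eq)
    with Suc expect_reached_Suc[OF \<open>t < n\<close>, of d] show ?case
      by (simp add: reach_prob_def)
  qed
  have "p v \<le> reach_prob p t" if t: "t < n" and v: "v \<in> set_pmf (F (arrivals ! t))" for t v
  proof -
    let ?i = "arrivals ! t"
    have i: "?i \<in> {1..n}" using arrival_in[OF t] .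
    have "pmf (F ?i) v * p v = expect (\<lambda>x. indicator {v} (x ?i) * pmf (rule d x) (Some ?i))"
      using hire[OF i v] by simp
    \<comment> \<open>Bounding the last hiring decision by 1 leaves the event that the step is
      reached and the value is \<open>v\<close>.\<close>
    also have "\<dots> \<le> expect (\<lambda>x. indicator {v} (x ?i) * reached d t x)"
      unfolding pmf_rule[OF t]
      by (intro integral_mono measure_pmf.integrable_const_bound[where B=1] mult_left_mono mult_right_le_one_le)
         (auto simp: reached_nonneg reached_le_1 pmf_le_1 abs_mult indicator_def mult_le_one)
    also have "\<dots> = measure_pmf.expectation (F ?i) (indicator {v}) * expect (reached d t)"
      unfolding value_law_def
      using i by (intro expectation_Pi_pmf_indep) (auto simp: reached_upd[OF t] reached_nonneg)
    also have "\<dots> = pmf (F ?i) v * reach_prob p t"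
      using reach[of t] t by (simp add: measure_pmf_single)
    finally show ?thesis
      using v by (simp add: pmf_positive)
  qed
  with p01 have "feasible p" by (auto simp: feasible_def)
  with p that show ?thesis by blast
qed

text \<open>Hiring with probability \<open>p v / reach_prob p t\<close> at step \<open>t\<close>
  compensates for the chance of not getting there.\<close>

lemma feasible_IIF:
  assumes p: "feasible p"
  obtains A where "stopping_rule n \<pi> A" "IIF_with n F p A"
proof -
  \<comment> \<open>The history includes the new value: \<open>last zs\<close> is the current value
    and \<open>length zs - 1\<close> the step counted from 0.\<close>
  define d where "d zs = bernoulli_pmf (p (last zs) / reach_prob p (length zs - 1))" for zs :: "real list"
  have p01: "0 \<le> p v" "p v \<le> 1" for v
    using p by (auto simp: feasible_def)
  \<comment> \<open>Outside the law of the arriving candidate the quotient may exceed 1;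
    \<open>bernoulli_pmf\<close> truncates it.\<close>
  define b where "b t v = pmf (bernoulli_pmf (p v / reach_prob p t)) True" for t v
  have b: "b t v * reach_prob p t = p v" if "t < n" "v \<in> set_pmf (F (arrivals ! t))" for t v
  proof -
    have "p v \<le> reach_prob p t"
      using p that by (auto simp: feasible_def)
    moreover from this have "0 \<le> reach_prob p t" using p01[of v] by linarith
    ultimately show ?thesis
      \<comment> \<open>If the step is reached with probability 0, feasibility forces
        \<open>p v = 0\<close>, so the product is right whatever \<open>b\<close> is.\<close>
      using p01[of v] by (cases "reach_prob p t = 0") (auto simp: b_def)
  qed
  have pmf_d: "pmf (d (map x (take (Suc t) arrivals))) True = b t (x (arrivals ! t))" if "t < n" for t x
  proof -
    have "take (Suc t) arrivals = take t arrivals @ [arrivals ! t]"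
      using that length_arrivals by (intro take_Suc_conv_app_nth) simp
    then show ?thesis
      using that length_arrivals by (simp add: d_def b_def)
  qed
  \<comment> \<open>The reaching probability is a premise here because its induction proof below
    uses this fact at the preceding step.\<close>
  have step: "expect (\<lambda>x. indicator {v} (x (arrivals ! t)) * pmf (rule d x) (Some (arrivals ! t)))
      = pmf (F (arrivals ! t)) v * p v"
    if t: "t < n" and reach: "expect (reached d t) = reach_prob p t" and v: "v \<in> set_pmf (F (arrivals ! t))" for t v
  proof -
    let ?i = "arrivals ! t"
    have "expect (\<lambda>x. indicator {v} (x ?i) * pmf (rule d x) (Some ?i)) =
        expect (\<lambda>x. (indicator {v} (x ?i) * b t (x ?i)) * reached d t x)"
      unfolding pmf_rule[OF t] pmf_d[OF t] by (simp add: mult_ac)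
    also have "\<dots> = measure_pmf.expectation (F ?i) (\<lambda>u. indicator {v} u * b t u) * expect (reached d t)"
      unfolding value_law_def using arrival_in[OF t]
      by (intro expectation_Pi_pmf_indep) (auto simp: reached_upd[OF t] reached_nonneg b_def)
    also have "measure_pmf.expectation (F ?i) (\<lambda>u. indicator {v} u * b t u) = pmf (F ?i) v * b t v"
      by (subst integral_measure_pmf[of "{v}"]) (auto simp: indicator_def split: if_splits)
    finally show ?thesis
      using b[OF t v] reach by (simp add: mult_ac)
  qed
  have reach: "expect (reached d t) = reach_prob p t" if "t \<le> n" for t
    using that
  proof (induction t)
    case 0
    then show ?case by (simp add: reached_def[abs_def] reach_prob_def)
  next
    case (Suc t)
    then have t: "t < n" by simp
    have "expect (\<lambda>x. pmf (rule d x) (Some (arrivals ! t))) = measure_pmf.expectation (F (arrivals ! t)) p"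
      using arrival_in[OF t] p01 step[OF t] Suc by (intro expect_hire_eq) simp_all
    with Suc expect_reached_Suc[OF t, of d] show ?case
      by (simp add: reach_prob_def)
  qed
  have "expect (\<lambda>x. indicator {v} (x i) * pmf (rule d x) (Some i)) = pmf (F i) v * p v"
    if "i \<in> {1..n}" "v \<in> set_pmf (F i)" for i v
  proof -
    from that(1) obtain t where t: "t < n" "i = arrivals ! t"
      by (rule arrival_cases)
    show ?thesis
      using step[OF t(1) reach] t that(2) by simp
  qed
  then have "IIF_with n F p (rule d)"
    unfolding IIF_with_iff using p01 by simp
  moreover have "stopping_rule n \<pi> (rule d)"
    unfolding stopping_rule_def arrivals_def by blast
  ultimately show ?thesis using that by blast
qed

section \<open>The lower bound and the existence of an optimal rule\<close>

lemma le_max_value: "i \<in> {1..n} \<Longrightarrow> x i \<le> Max (x ` {1..n})" for x :: "nat \<Rightarrow> real"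
  by simp

lemma max_value_nonneg:
  assumes "x \<in> set_pmf (value_law n F)"
  shows "0 \<le> Max (x ` {1..n})"
proof -
  have one: "1 \<in> {1..n}" using n_pos by simp
  have "0 \<le> x 1"
    using value_nonneg[OF one] value_law_component_in_set_pmf[OF one assms] by blast
  also have "x 1 \<le> Max (x ` {1..n})"
    using le_max_value[OF one] .
  finally show ?thesis .
qed

lemma expected_value_le_expected_max:
  assumes "offline_algorithm n B"
  shows "expected_value n F B \<le> expected_max n F"
  unfolding expected_value_def expected_max_def nn_integral_outcome
proof (intro nn_integral_mono_AE, simp only: AE_measure_pmf_iff, intro ballI)
  fix x assume x: "x \<in> set_pmf (value_law n F)"
  have "ennreal (hired_value x h) \<le> ennreal (Max (x ` {1..n}))" if h: "h \<in> set_pmf (B x)" for h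
  proof -
    have "h \<in> insert None (Some ` {1..n})"
      using assms h by (auto simp: offline_algorithm_def)
    then show ?thesis
      using max_value_nonneg[OF x] by (auto simp: hired_value_def intro!: ennreal_leI)
  qed
  then have "(\<integral>\<^sup>+h. ennreal (hired_value x h) \<partial>B x) \<le> (\<integral>\<^sup>+h. ennreal (Max (x ` {1..n})) \<partial>B x)"
    by (intro nn_integral_mono_AE) (simp add: AE_measure_pmf_iff)
  then show "(\<integral>\<^sup>+h. (case (x, h) of (x, h) \<Rightarrow> ennreal (hired_value x h)) \<partial>B x) \<le> ennreal (Max (x ` {1..n}))"
    by simp
qed

lemma expected_value_hires_maximum:
  assumes "hires_maximum n A"
  shows "expected_value n F A = expected_max n F"
  unfolding expected_value_def expected_max_def nn_integral_outcome
proof (intro nn_integral_cong)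
  fix x
  have "hired_value x h = Max (x ` {1..n})" if h: "h \<in> set_pmf (A x)" for h
  proof -
    obtain i where "h = Some i" "is_arg_max x (\<lambda>j. j \<in> {1..n}) i"
      using assms h by (auto simp: hires_maximum_def)
    then show ?thesis
      using is_arg_max_eq_Max[of "{1..n}" x i] by (simp add: hired_value_def)
  qed
  then have "(\<integral>\<^sup>+h. ennreal (hired_value x h) \<partial>A x) = (\<integral>\<^sup>+h. ennreal (Max (x ` {1..n})) \<partial>A x)"
    by (intro nn_integral_cong_AE) (simp add: AE_measure_pmf_iff)
  then show "(\<integral>\<^sup>+h. (case (x, h) of (x, h) \<Rightarrow> ennreal (hired_value x h)) \<partial>A x) = ennreal (Max (x ` {1..n}))"
    by simp
qed

lemma optimal_offline_hires_maximum:
  assumes "hires_maximum n A"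
  shows "optimal_offline n F A"
proof -
  have "Some ` {i. is_arg_max x (\<lambda>j. j \<in> {1..n}) i} \<subseteq> insert None (Some ` {1..n})" for x :: "nat \<Rightarrow> real"
    by (auto simp: is_arg_max_def)
  then have "offline_algorithm n A"
    using assms unfolding hires_maximum_def offline_algorithm_def by blast
  then show ?thesis
    using expected_value_hires_maximum[OF assms] expected_value_le_expected_max
    by (simp add: optimal_offline_def)
qed

section \<open>A feasible function worth half the offline optimum\<close>

definition max_law :: "real pmf" where
  "max_law = map_pmf (\<lambda>x. Max (x ` {1..n})) (value_law n F)"

text \<open>Union bound: the maximum is attained, so if it equals \<open>v\<close> then some
  candidate has value \<open>v\<close>.\<close>

lemma pmf_max_law_le: "pmf max_law v \<le> (\<Sum>i\<in>{1..n}. pmf (F i) v)"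
proof -
  have "pmf max_law v \<le> measure (value_law n F) (\<Union>i\<in>{1..n}. {x. x i = v})"
    unfolding max_law_def pmf_map
  proof (intro measure_pmf.finite_measure_mono)
    show "(\<lambda>x. Max (x ` {1..n})) -` {v} \<subseteq> (\<Union>i\<in>{1..n}. {x. x i = v})"
    proof
      fix x assume "x \<in> (\<lambda>x. Max (x ` {1..n})) -` {v}"
      then have "v \<in> x ` {1..n}"
        using Max_in[of "x ` {1..n}"] n_pos by auto
      then show "x \<in> (\<Union>i\<in>{1..n}. {x. x i = v})" by auto
    qed
  qed simp
  also have "\<dots> \<le> (\<Sum>i\<in>{1..n}. measure (value_law n F) {x. x i = v})"
    by (intro measure_pmf.finite_measure_subadditive_finite) auto
  also have "\<dots> = (\<Sum>i\<in>{1..n}. pmf (F i) v)"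
  proof (rule sum.cong[OF refl])
    fix i assume "i \<in> {1..n}"
    then show "measure (value_law n F) {x. x i = v} = pmf (F i) v"
      by (subst value_law_component[of i n F, symmetric]) (simp_all add: pmf_map vimage_def)
  qed
  finally show ?thesis .
qed

text \<open>
  Half the rate at which the offline optimum hires a candidate of value \<open>v\<close>, averaged over the
  candidates that can have this value.
\<close>

definition half_max_rate :: "real \<Rightarrow> real" where
  "half_max_rate v = pmf max_law v / (2 * (\<Sum>i\<in>{1..n}. pmf (F i) v))"

lemma half_max_rate_bounds: "0 \<le> half_max_rate v" "half_max_rate v \<le> 1 / 2"
proof -
  have "0 \<le> (\<Sum>i\<in>{1..n}. pmf (F i) v)" by (simp add: sum_nonneg)
  then show "0 \<le> half_max_rate v" "half_max_rate v \<le> 1 / 2"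
    using pmf_max_law_le[of v]
    by (auto simp: half_max_rate_def divide_simps)
qed

lemma sum_mult_half_max_rate: "(\<Sum>i\<in>{1..n}. pmf (F i) v) * half_max_rate v = pmf max_law v / 2"
proof (cases "(\<Sum>i\<in>{1..n}. pmf (F i) v) = 0")
  \<comment> \<open>Where no candidate can have value \<open>v\<close>, the maximum cannot have it
    either, so both sides vanish.\<close>
  case True
  then show ?thesis using pmf_max_law_le[of v] by (simp add: order_antisym)
qed (simp add: half_max_rate_def)

text \<open>Summing over candidates first, the weight at \<open>v\<close> becomes half the
  probability that the maximum is \<open>v\<close>. The case \<open>g = 1\<close> serves
  feasibility, \<open>g = ennreal\<close> the value.\<close>

lemma sum_nn_integral_half_max_rate:
  "(\<Sum>i\<in>{1..n}. \<integral>\<^sup>+v. g v * ennreal (half_max_rate v) \<partial>F i) = 1 / 2 * (\<integral>\<^sup>+v. g v \<partial>max_law)"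
proof -
  have "(\<Sum>i\<in>{1..n}. \<integral>\<^sup>+v. g v * ennreal (half_max_rate v) \<partial>F i) =
      (\<integral>\<^sup>+v. (\<Sum>i\<in>{1..n}. ennreal (pmf (F i) v) * (g v * ennreal (half_max_rate v))) \<partial>count_space UNIV)"
    by (subst nn_integral_sum) (simp_all add: nn_integral_measure_pmf[of "F _"])
  also have "\<dots> = (\<integral>\<^sup>+v. 1 / 2 * (ennreal (pmf max_law v) * g v) \<partial>count_space UNIV)"
  proof (rule nn_integral_cong)
    fix v
    have "(\<Sum>i\<in>{1..n}. ennreal (pmf (F i) v) * (g v * ennreal (half_max_rate v))) =
        ennreal ((\<Sum>i\<in>{1..n}. pmf (F i) v) * half_max_rate v) * g v"
      using half_max_rate_bounds[of v]
      by (simp add: ennreal_mult sum_nonneg sum_distrib_left mult_ac flip: sum_ennreal)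
    also have "ennreal ((\<Sum>i\<in>{1..n}. pmf (F i) v) * half_max_rate v) = 1 / 2 * ennreal (pmf max_law v)"
      unfolding sum_mult_half_max_rate
      by (subst ennreal_divide_numeral[symmetric]) (simp_all add: divide_ennreal_def mult.commute)
    finally show "(\<Sum>i\<in>{1..n}. ennreal (pmf (F i) v) * (g v * ennreal (half_max_rate v))) =
        1 / 2 * (ennreal (pmf max_law v) * g v)"
      by (simp add: mult_ac)
  qed
  also have "\<dots> = 1 / 2 * (\<integral>\<^sup>+v. g v \<partial>max_law)"
    by (simp add: nn_integral_cmult nn_integral_measure_pmf[of max_law])
  finally show ?thesis .
qed

text \<open>All hires together use up probability 1/2, so every step is reached with probability at
  least 1/2, which the function never exceeds.\<close>

lemma feasible_half_max_rate: "feasible half_max_rate"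
proof -
  let ?E = "\<lambda>i. measure_pmf.expectation (F i) half_max_rate"
  have E_nonneg: "0 \<le> ?E i" for i
    by (simp add: half_max_rate_bounds)
  have le1: "half_max_rate v \<le> 1" for v
    using half_max_rate_bounds(2)[of v] by linarith
  have "integrable (F i) half_max_rate" for i
    by (rule measure_pmf.integrable_const_bound[where B=1]) (auto simp: half_max_rate_bounds le1)
  then have "ennreal (\<Sum>i\<in>{1..n}. ?E i) = (\<Sum>i\<in>{1..n}. \<integral>\<^sup>+v. 1 * ennreal (half_max_rate v) \<partial>F i)"
    by (simp add: nn_integral_eq_integral half_max_rate_bounds E_nonneg flip: sum_ennreal)
  also have "\<dots> = 1 / 2"
    using sum_nn_integral_half_max_rate[of "\<lambda>_. 1"] by simp
  also have "\<dots> = ennreal (1 / 2)"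
    by (simp flip: ennreal_numeral add: divide_ennreal ennreal_1[symmetric] del: ennreal_1)
  finally have sum: "(\<Sum>i\<in>{1..n}. ?E i) = 1 / 2"
    using E_nonneg by (subst (asm) ennreal_inj) (auto intro: sum_nonneg)
  have "half_max_rate v \<le> reach_prob half_max_rate t" if "t < n" for t v
  proof -
    have "(\<Sum>s<t. ?E (arrivals ! s)) \<le> (\<Sum>s<n. ?E (arrivals ! s))"
      using that E_nonneg by (intro sum_mono2) auto
    also have "\<dots> = 1 / 2"
      using sum sum_arrivals[of ?E] by linarith
    finally show ?thesis
      using half_max_rate_bounds(2)[of v] by (simp add: reach_prob_def)
  qed
  then show ?thesis
    using half_max_rate_bounds le1 by (simp add: feasible_def)
qed

lemma fair_value_half_max_rate: "fair_value half_max_rate = 1 / 2 * expected_max n F"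
  unfolding fair_value_def sum_nn_integral_half_max_rate expected_max_def max_law_def by simp

section \<open>Attainment of the optimum\<close>

lemma exists_optimal_feasible: "\<exists>p. feasible p \<and> (\<forall>p'. feasible p' \<longrightarrow> fair_value p' \<le> fair_value p)"
proof (cases "expected_max n F = \<infinity>")
  case True
  then have "fair_value half_max_rate = \<infinity>"
    unfolding fair_value_half_max_rate by (simp add: ennreal_mult_top divide_ennreal_def)
  then have "\<forall>p'. feasible p' \<longrightarrow> fair_value p' \<le> fair_value half_max_rate"
    by simp
  with feasible_half_max_rate show ?thesis by blast
next
  case False
  \<comment> \<open>Each value is at most the maximum, hence has finite mean; it is the dominating
    function for the convergence of \<open>fair_value\<close>.\<close>
  have fin: "(\<integral>\<^sup>+v. ennreal v \<partial>F i) < \<infinity>" if i: "i \<in> {1..n}" for i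
  proof -
    have "(\<integral>\<^sup>+v. ennreal v \<partial>F i) = (\<integral>\<^sup>+x. ennreal (x i) \<partial>value_law n F)"
      using nn_integral_value_law_component[OF i] by simp
    also have "\<dots> \<le> expected_max n F"
      unfolding expected_max_def using i by (intro nn_integral_mono ennreal_leI) simp
    finally show ?thesis using False by (simp add: less_top order_le_less_trans)
  qed
  define S where "S = (\<Union>i\<in>{1..n}. set_pmf (F i))"
  have "countable S" by (simp add: S_def)
  obtain f :: "nat \<Rightarrow> ennreal" where f: "incseq f" "range f \<subseteq> fair_value ` {p. feasible p}"
      "Sup (fair_value ` {p. feasible p}) = (SUP k. f k)"
  proof -
    have "fair_value ` {p. feasible p} \<noteq> {}"
      using feasible_half_max_rate by blast
    from ennreal_Sup_countable_SUP[OF this] that show ?thesis by blast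
  qed
  have "\<forall>k. \<exists>p. feasible p \<and> f k = fair_value p"
    using f(2) by (simp add: image_subset_iff image_iff)
  then obtain P where P: "\<And>k. feasible (P k)" "\<And>k. f k = fair_value (P k)"
    using choice[of "\<lambda>k p. feasible p \<and> f k = fair_value p"] by blast
  have P01: "0 \<le> P k v" "P k v \<le> 1" for k v
    using P(1)[of k] by (auto simp: feasible_def)
  \<comment> \<open>Diagonal extraction: functions into [0,1] on a countable set have a pointwise
    convergent subsequence.\<close>
  obtain r where r: "strict_mono (r :: nat \<Rightarrow> nat)" "\<And>v. v \<in> S \<Longrightarrow> \<exists>l. (\<lambda>k. P (r k) v) \<longlonglongrightarrow> l"
    by (rule function_convergent_subsequence[of S P 1]) (auto simp: P01 \<open>countable S\<close>)
  define p where "p v = (if v \<in> S then lim (\<lambda>k. P (r k) v) else 0)" for v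
  have conv: "(\<lambda>k. P (r k) v) \<longlonglongrightarrow> p v" if "v \<in> S" for v
    using r(2)[OF that] that by (auto simp: p_def convergent_LIMSEQ_iff[symmetric] convergent_def)
  have AE_conv: "AE v in F i. (\<lambda>k. P (r k) v) \<longlonglongrightarrow> p v" if "i \<in> {1..n}" for i
    unfolding AE_measure_pmf_iff using that conv S_def by blast
  have p01: "0 \<le> p v" "p v \<le> 1" for v
  proof -
    have "0 \<le> p v \<and> p v \<le> 1"
    proof (cases "v \<in> S")
      case True
      show ?thesis
        using LIMSEQ_le_const[OF conv[OF True], of 0] LIMSEQ_le_const2[OF conv[OF True], of 1] P01 by blast
    next
      case False
      then show ?thesis by (simp only: p_def if_False) simp
    qed
    then show "0 \<le> p v" "p v \<le> 1" by auto
  qed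
  have E: "(\<lambda>k. measure_pmf.expectation (F i) (P (r k))) \<longlonglongrightarrow> measure_pmf.expectation (F i) p" if "i \<in> {1..n}" for i
    by (rule integral_dominated_convergence[where w = "\<lambda>_. 1"])
       (use AE_conv[OF that] in \<open>simp_all add: P01\<close>)
  have reach: "(\<lambda>k. reach_prob (P (r k)) t) \<longlonglongrightarrow> reach_prob p t" if "t < n" for t
    unfolding reach_prob_def using that
    by (intro tendsto_diff tendsto_const tendsto_sum E arrival_in) simp
  have "feasible p"
    unfolding feasible_def
  proof (intro conjI allI impI ballI)
    fix t v assume t: "t < n" and v: "v \<in> set_pmf (F (arrivals ! t))"
    then have "v \<in> S" using arrival_in S_def by blast
    from conv[OF this] reach[OF t] show "p v \<le> reach_prob p t"
      by (rule LIMSEQ_le) (use P(1) t v in \<open>auto simp: feasible_def\<close>)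
  qed (use p01 in auto)
  moreover have "fair_value p' \<le> fair_value p" if "feasible p'" for p'
  proof -
    have "(\<lambda>k. fair_value (P (r k))) \<longlonglongrightarrow> fair_value p"
      unfolding fair_value_def
    proof (intro tendsto_sum)
      fix i assume i: "i \<in> {1..n}"
      show "(\<lambda>k. \<integral>\<^sup>+v. ennreal v * ennreal (P (r k) v) \<partial>F i) \<longlonglongrightarrow> (\<integral>\<^sup>+v. ennreal v * ennreal (p v) \<partial>F i)"
      proof (rule nn_integral_dominated_convergence[where w = ennreal])
        show "AE v in F i. ennreal v * ennreal (P (r k) v) \<le> ennreal v" for k
        proof (intro AE_I2)
          fix v
          have "ennreal v * ennreal (P (r k) v) \<le> ennreal v * 1"
            using P01[of "r k" v] by (intro mult_left_mono) (auto simp: ennreal_le_1)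
          then show "ennreal v * ennreal (P (r k) v) \<le> ennreal v" by simp
        qed
        show "AE v in F i. (\<lambda>k. ennreal v * ennreal (P (r k) v)) \<longlonglongrightarrow> ennreal v * ennreal (p v)"
          using AE_conv[OF i]
          by (rule eventually_mono) (intro ennreal_tendsto_cmult tendsto_ennrealI; simp)
      qed (use fin[OF i] in auto)
    qed
    \<comment> \<open>A subsequence of the maximising sequence \<open>f\<close> still tends to its
      supremum.\<close>
    moreover have "(\<lambda>k. fair_value (P (r k))) \<longlonglongrightarrow> (SUP k. f k)"
      using LIMSEQ_subseq_LIMSEQ[OF LIMSEQ_SUP[OF f(1)] r(1)] P(2) by (simp add: o_def)
    ultimately have "fair_value p = Sup (fair_value ` {p. feasible p})"
      unfolding f(3) by (rule LIMSEQ_unique)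
    moreover have "fair_value p' \<in> fair_value ` {p. feasible p}"
      using \<open>feasible p'\<close> by blast
    ultimately show ?thesis by (simp only: Sup_upper)
  qed
  ultimately show ?thesis by blast
qed

text \<open>Rules and feasible functions correspond in both directions with equal value, so an
  optimal function yields an optimal rule.\<close>

lemma exists_optimal_IIF_stopping_rule: "\<exists>A. optimal_IIF_stopping_rule n F \<pi> A"
proof -
  obtain p where p: "feasible p" "\<And>p'. feasible p' \<Longrightarrow> fair_value p' \<le> fair_value p"
    using exists_optimal_feasible by auto
  obtain A where A: "stopping_rule n \<pi> A" "IIF_with n F p A"
    by (rule feasible_IIF[OF p(1)])
  have "expected_value n F B \<le> expected_value n F A" if "stopping_rule n \<pi> B" "IIF n F B" for B
  proof -
    from that obtain p' where "feasible p'" "IIF_with n F p' B"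
      by (rule IIF_feasible)
    then show ?thesis
      using p(2) expected_value_IIF[OF A] expected_value_IIF[OF that(1)] by simp
  qed
  with A show ?thesis
    unfolding optimal_IIF_stopping_rule_def IIF_def by blast
qed

text \<open>An optimal rule does at least as well as one that realises
  \<open>half_max_rate\<close>.\<close>

lemma optimal_IIF_stopping_rule_ge:
  assumes "optimal_IIF_stopping_rule n F \<pi> A"
  shows "1 / 2 * expected_max n F \<le> expected_value n F A"
proof -
  obtain B where B: "stopping_rule n \<pi> B" "IIF_with n F half_max_rate B"
    by (rule feasible_IIF[OF feasible_half_max_rate])
  then have "expected_value n F B \<le> expected_value n F A"
    using assms unfolding optimal_IIF_stopping_rule_def IIF_def by blast
  then show ?thesis
    using expected_value_IIF[OF B] fair_value_half_max_rate by simp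
qed

end

section \<open>Tightness\<close>

text \<open>For \<open>0 < e < 1\<close> both candidates have mean 1, but the second owes it to an
  event of probability \<open>e\<close>. For small \<open>e\<close> the maximum collects almost both
  means.\<close>

definition prophet_law :: "real \<Rightarrow> nat \<Rightarrow> real pmf" where
  "prophet_law e i = (if i = 1 then return_pmf 1 else map_pmf (\<lambda>b. if b then 1 / e else 0) (bernoulli_pmf e))"

lemma hiring_prophet_law:
  assumes "0 < e"
  shows "hiring 2 (prophet_law e) id"
  by standard (use assms in \<open>auto simp: hiring_instance_def prophet_law_def permutes_id\<close>)

lemma nn_integral_prophet_law_2:
  assumes "0 < e" "e < 1"
  shows "(\<integral>\<^sup>+v. g v \<partial>prophet_law e 2) = g (1 / e) * ennreal e + g 0 * ennreal (1 - e)"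
  using assms by (simp add: prophet_law_def)

lemma expected_max_prophet_law:
  assumes e: "0 < e" "e < 1"
  shows "expected_max 2 (prophet_law e) = ennreal (2 - e)"
proof -
  have "expected_max 2 (prophet_law e) = (\<integral>\<^sup>+x. ennreal (max 1 (x 2)) \<partial>value_law 2 (prophet_law e))"
    unfolding expected_max_def
  proof (intro nn_integral_cong_AE, simp only: AE_measure_pmf_iff, intro ballI)
    fix x assume x: "x \<in> set_pmf (value_law 2 (prophet_law e))"
    have "{1..2} = {1, 2 :: nat}" by auto
    moreover have "x 1 = 1"
      using value_law_component_in_set_pmf[OF _ x, of 1] by (simp add: prophet_law_def)
    ultimately show "ennreal (Max (x ` {1..2})) = ennreal (max 1 (x 2))"
      by simp
  qed
  also have "\<dots> = ennreal (max 1 (1 / e)) * ennreal e + ennreal (1 - e)"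
    using nn_integral_value_law_component[of 2 2, where g = "\<lambda>v. ennreal (max 1 v)" and F = "prophet_law e"] nn_integral_prophet_law_2[OF e]
    by simp
  also have "\<dots> = ennreal (2 - e)"
  proof -
    have "max 1 (1 / e) * e = 1" using e by (simp add: max_def divide_simps)
    moreover have "ennreal (max 1 (1 / e)) * ennreal e = ennreal (max 1 (1 / e) * e)"
      by (rule ennreal_mult[symmetric]) (use e in auto)
    moreover have "ennreal 1 + ennreal (1 - e) = ennreal (1 + (1 - e))"
      by (rule ennreal_plus[symmetric]) (use e in auto)
    ultimately show ?thesis by simp
  qed
  finally show ?thesis .
qed

text \<open>Either candidate contributes exactly its hiring rate at its positive value, since
  \<open>1 / e\<close> has probability \<open>e\<close>. The second can be hired only if the first
  was not, which bounds the two rates together by 1.\<close>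

lemma expected_value_prophet_law_le:
  assumes e: "0 < e" "e < 1" and A: "optimal_IIF_stopping_rule 2 (prophet_law e) id A"
  shows "expected_value 2 (prophet_law e) A \<le> 1"
proof -
  interpret hiring 2 "prophet_law e" id
    using hiring_prophet_law[OF e(1)] .
  have arr: "arrivals = [1, 2]"
    by (simp add: arrivals_def upt_rec)
  obtain p where p: "feasible p" "IIF_with 2 (prophet_law e) p A"
    by (rule IIF_feasible) (use A in \<open>auto simp: optimal_IIF_stopping_rule_def\<close>)
  have p01: "0 \<le> p v" for v using p(1) by (simp add: feasible_def)
  have "1 / e \<in> set_pmf (prophet_law e (arrivals ! 1))"
    using e by (auto simp: arr prophet_law_def intro!: image_eqI[of _ _ True])
  then have "p (1 / e) \<le> reach_prob p 1"
    using p(1) by (auto simp: feasible_def)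
  also have "reach_prob p 1 = 1 - p 1"
    by (simp add: reach_prob_def arr prophet_law_def)
  finally have le: "p 1 + p (1 / e) \<le> 1" by simp
  have "expected_value 2 (prophet_law e) A = fair_value p"
    using expected_value_IIF p(2) A unfolding optimal_IIF_stopping_rule_def by blast
  also have "\<dots> = (\<Sum>i\<in>{1, 2}. \<integral>\<^sup>+v. ennreal v * ennreal (p v) \<partial>prophet_law e i)"
    unfolding fair_value_def by (rule sum.cong) auto
  also have "\<dots> = ennreal (p 1) + ennreal (1 / e) * ennreal (p (1 / e)) * ennreal e"
  proof -
    have "prophet_law e 1 = return_pmf 1" by (simp add: prophet_law_def)
    then show ?thesis
      using nn_integral_prophet_law_2[OF e, of "\<lambda>v. ennreal v * ennreal (p v)"] by simp
  qed
  also have "\<dots> = ennreal (p 1 + p (1 / e))"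
    using e p01 by (simp flip: ennreal_mult ennreal_plus)
  also have "\<dots> \<le> 1"
    using le by (simp add: ennreal_le_1)
  finally show ?thesis .
qed

text \<open>Supplies the offline witness for the tightness claim.\<close>

lemma exists_hires_maximum:
  assumes "1 \<le> n"
  shows "\<exists>A. hires_maximum n A"
proof
  have ex: "\<exists>i. is_arg_max x (\<lambda>j. j \<in> {1..n}) i" for x :: "nat \<Rightarrow> real"
  proof -
    have "Max (x ` {1..n}) \<in> x ` {1..n}"
      using assms by (intro Max_in) auto
    then obtain i where "i \<in> {1..n}" "x i = Max (x ` {1..n})"
      by (metis imageE)
    then show ?thesis by (auto simp: is_arg_max_linorder)
  qed
  have "is_arg_max x (\<lambda>j. j \<in> {1..n}) (SOME i. is_arg_max x (\<lambda>j. j \<in> {1..n}) i)" for x :: "nat \<Rightarrow> real"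
    using ex by (rule someI_ex)
  then show "hires_maximum n (\<lambda>x. return_pmf (Some (SOME i. is_arg_max x (\<lambda>j. j \<in> {1..n}) i)))"
    by (simp add: hires_maximum_def)
qed

theorem mainTheorem9:
  shows "(\<forall>n F \<pi>. hiring_instance n F \<pi> \<longrightarrow>
            (\<exists>OPTOnIIF. optimal_IIF_stopping_rule n F \<pi> OPTOnIIF) \<and>
            (\<forall>OPTOff. hires_maximum n OPTOff \<longrightarrow>
               optimal_offline n F OPTOff \<and>
               expected_value n F OPTOff = expected_max n F \<and>
               (\<forall>OPTOnIIF. optimal_IIF_stopping_rule n F \<pi> OPTOnIIF \<longrightarrow>
                  expected_value n F OPTOnIIF \<ge> 1 / 2 * expected_value n F OPTOff)))
       \<and> (\<forall>c::real. c > 1 / 2 \<longrightarrow>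
            (\<exists>n F \<pi> OPTOff OPTOnIIF. hiring_instance n F \<pi> \<and>
               hires_maximum n OPTOff \<and>
               optimal_IIF_stopping_rule n F \<pi> OPTOnIIF \<and>
               expected_value n F OPTOnIIF < ennreal c * expected_value n F OPTOff))"
proof (intro conjI allI impI)
  fix n F \<pi> assume "hiring_instance n F \<pi>"
  then interpret hiring n F \<pi> by unfold_locales
  show "\<exists>A. optimal_IIF_stopping_rule n F \<pi> A"
    by (rule exists_optimal_IIF_stopping_rule)
  fix OPTOff assume max: "hires_maximum n OPTOff"
  show "optimal_offline n F OPTOff"
    using max by (rule optimal_offline_hires_maximum)
  show eq: "expected_value n F OPTOff = expected_max n F"
    using max by (rule expected_value_hires_maximum)
  fix A assume "optimal_IIF_stopping_rule n F \<pi> A"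
  then show "1 / 2 * expected_value n F OPTOff \<le> expected_value n F A"
    unfolding eq by (rule optimal_IIF_stopping_rule_ge)
next
  fix c :: real assume c: "1 / 2 < c"
  \<comment> \<open>Chosen so that \<open>c * (2 - e) = c + 1 / 2\<close>, which exceeds 1;
    \<open>c > 1 / 2\<close> puts \<open>e\<close> strictly between 0 and 1.\<close>
  define e where "e = 1 - 1 / (2 * c)"
  have e: "0 < e" "e < 1"
    using c by (auto simp: e_def divide_simps)
  interpret hiring 2 "prophet_law e" id
    using hiring_prophet_law[OF e(1)] .
  obtain OPTOff :: algorithm where max: "hires_maximum 2 OPTOff"
    using exists_hires_maximum[of 2] by auto
  obtain A where A: "optimal_IIF_stopping_rule 2 (prophet_law e) id A"
    using exists_optimal_IIF_stopping_rule by blast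
  have "expected_value 2 (prophet_law e) A \<le> ennreal 1"
    using expected_value_prophet_law_le[OF e A] by simp
  also have "\<dots> < ennreal (c * (2 - e))"
  proof -
    have "c * (2 - e) = c + 1 / 2" using c by (simp add: e_def field_simps)
    with c show ?thesis by (intro ennreal_lessI) auto
  qed
  also have "\<dots> = ennreal c * expected_value 2 (prophet_law e) OPTOff"
    using c e expected_value_hires_maximum[OF max] expected_max_prophet_law[OF e] by (simp add: ennreal_mult)
  finally show "\<exists>n F \<pi> OPTOff OPTOnIIF. hiring_instance n F \<pi> \<and>
      hires_maximum n OPTOff \<and> optimal_IIF_stopping_rule n F \<pi> OPTOnIIF \<and>
      expected_value n F OPTOnIIF < ennreal c * expected_value n F OPTOff"
    using hiring max A by (intro exI conjI)
qed

end
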